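(* For each integer $n \ge 0$, let $d_n$ be the smallest positive integer such that $d_n \cdot (1^n + 2^n + \cdots + x^n)$ is a polynomial in $x$ with integer coefficients (here $1^n+2^n+\cdots+x^n$ denotes the unique polynomial in $\mathbb{Q}[x]$ of degree $n+1$ agreeing with this sum for all positive integers $x$). Then, with $p$ always denoting a prime: (i) if $p \mid d_n$ then $p \le n+1$; (ii) $d_n$ is divisible by $n+1$, and the quotient $q_n := d_n/(n+1)$ is squarefree; (iii) $d_n$ is even for all $n \ge 1$, while $q_n$ is odd if and only if $n = 2^r - 1$ for some integer $r \ge 0$; (iv) if $p \mid q_n$ then $p \le M_n$, where $M_n := \frac{n+2}{2}$ if $n$ is even and $M_n := \frac{n+2}{3}$ if $n$ is odd. *)

theory Defs
  imports
    Complex_Main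
    "HOL-Computational_Algebra.Polynomial"
    "HOL-Computational_Algebra.Squarefree"
begin

definition is_power_sum_poly :: "nat \<Rightarrow> rat poly \<Rightarrow> bool" where
  "is_power_sum_poly n P \<longleftrightarrow>
     degree P = n + 1 \<and>
     (\<forall>x::nat. x > 0 \<longrightarrow> poly P (of_nat x) = (\<Sum>k=1..x. of_nat k ^ n))"

lemma telescoping_binomial_sum:
  "(\<Sum>k<n. of_nat (Suc n choose k) * (\<Sum>j=1..x. of_nat j ^ k))
     + of_nat (Suc n) * (\<Sum>j=1..x. of_nat j ^ n) = (of_nat x + 1 :: rat) ^ Suc n - 1"
proof (induction x)
  case 0
  show ?case by simp
next
  case (Suc x)
  have "(of_nat (Suc x) + 1 :: rat) ^ Suc n
          = (\<Sum>k\<le>Suc n. of_nat (Suc n choose k) * of_nat (Suc x) ^ k)"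
    unfolding binomial_ring by simp
  also have "\<dots> = (\<Sum>k<n. of_nat (Suc n choose k) * of_nat (Suc x) ^ k)
      + of_nat (Suc n) * of_nat (Suc x) ^ n + of_nat (Suc x) ^ Suc n"
    by (simp only: lessThan_Suc_atMost [symmetric] sum.lessThan_Suc binomial_n_n
          of_nat_1 mult_1 binomial_Suc_n)
  finally show ?case
    using Suc.IH by (simp add: sum.distrib algebra_simps)
qed

lemma ex_is_power_sum_poly: "\<exists>P. is_power_sum_poly n P"
proof (induction n rule: less_induct)
  case (less n)
  then obtain S where S: "\<And>k. k < n \<Longrightarrow> is_power_sum_poly k (S k)"
    by metis
  define R where "R = (\<Sum>k<n. smult (of_nat (Suc n choose k)) (S k)) + 1"
  define P where "P = smult (1 / of_nat (Suc n)) ([:1, 1:] ^ Suc n - R)"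
  have "degree (\<Sum>k<n. smult (of_nat (Suc n choose k)) (S k)) \<le> n"
    by (rule degree_sum_le)
       (use S in \<open>auto simp: is_power_sum_poly_def intro: order_trans [OF degree_smult_le]\<close>)
  then have "degree R < Suc n"
    unfolding R_def using degree_add_le [of _ n "1 :: rat poly"] by (simp add: less_Suc_eq_le)
  moreover have "degree ([:1, 1 :: rat:] ^ Suc n) = Suc n"
    by (rule degree_linear_power)
  ultimately have "degree ([:1, 1:] ^ Suc n - R) = Suc n"
    using degree_add_eq_left [of "- R" "[:1, 1:] ^ Suc n"]
    by (simp only: degree_minus diff_conv_add_uminus)
  then have "degree P = n + 1"
    unfolding P_def by (simp del: power_Suc of_nat_Suc)
  moreover have "poly P (of_nat x) = (\<Sum>k=1..x. of_nat k ^ n)" if "x > 0" for x :: nat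
  proof -
    have "poly R (of_nat x)
            = (\<Sum>k<n. of_nat (Suc n choose k) * (\<Sum>j=1..x. of_nat j ^ k)) + 1"
      unfolding R_def using S that by (simp add: poly_sum is_power_sum_poly_def)
    then have "poly ([:1, 1:] ^ Suc n - R) (of_nat x)
                 = of_nat (Suc n) * (\<Sum>j=1..x. of_nat j ^ n)"
      using telescoping_binomial_sum [of n x]
      by (simp add: poly_power algebra_simps del: power_Suc of_nat_Suc)
    then show ?thesis
      unfolding P_def by (simp del: power_Suc of_nat_Suc)
  qed
  ultimately show ?case
    unfolding is_power_sum_poly_def by blast
qed

lemma ex1_is_power_sum_poly: "\<exists>!P. is_power_sum_poly n P"
proof (rule ex_ex1I [OF ex_is_power_sum_poly])
  fix P Q
  assume PQ: "is_power_sum_poly n P" "is_power_sum_poly n Q"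
  have "(of_nat :: nat \<Rightarrow> rat) ` {0<..} \<subseteq> {x. poly (P - Q) x = 0}"
    using PQ by (auto simp: is_power_sum_poly_def)
  moreover have "infinite ((of_nat :: nat \<Rightarrow> rat) ` {0<..})"
    by (simp add: finite_image_iff infinite_Ioi)
  ultimately have "P - Q = 0"
    using poly_roots_finite finite_subset by metis
  then show "P = Q" by simp
qed

definition power_sum_poly :: "nat \<Rightarrow> rat poly" where
  "power_sum_poly n = (THE P. is_power_sum_poly n P)"

definition power_sum_denom :: "nat \<Rightarrow> nat" where
  "power_sum_denom n =
     (LEAST d. d > 0 \<and> (\<forall>i. coeff (smult (of_nat d) (power_sum_poly n)) i \<in> \<int>))"

(* This is division on nat, so a statement about it should come with
   (n + 1) dvd power_sum_denom n. *)
definition power_sum_quot :: "nat \<Rightarrow> nat" where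
  "power_sum_quot n = power_sum_denom n div (n + 1)"

definition power_sum_bound :: "nat \<Rightarrow> rat" where
  "power_sum_bound n =
     (if even n then (of_nat n + 2) / 2 else (of_nat n + 2) / 3)"

end

(* The power sum polynomial differs from 1/(n+1) * sum_k C(n+1,k) B_k x^(n+1-k) by an integer
   polynomial, and the k = 0 coefficient is 1/(n+1). Hence d_n = (n+1) q_n, where q_n is the least
   common denominator of the numbers C(n+1,k) B_k with k <= n. As in the von Staudt-Clausen
   theorem, evaluating Faulhaber's formula at x = p gives an induction showing that p B_k is
   p-integral (so q_n is squarefree), that B_k itself is p-integral unless (p-1) | k, and that
   B_k - 1/2 is 2-integral for k = 1 and for even k > 0. So a prime p | q_n requires some
   0 < k <= n with (p-1) | k and C(n+1,k) prime to p; the bounds follow by reducing the top of the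
   binomial coefficient modulo p, and parity by taking k to be the largest power of 2 dividing
   n+1. *)

theory Submission
  imports
    "HOL-Number_Theory.Residue_Primitive_Roots"
    "HOL-Algebra.Exponent"
    Defs
begin

section \<open>Bernoulli numbers and Faulhaber's formula\<close>

text \<open>Convention B_1 = -1/2, which suits sums over j < m. The recurrence is the vanishing of
  the sum of C(n+1,k) B_k over k <= n, solved for B_n.\<close>

fun bern :: "nat \<Rightarrow> rat" where
  "bern n = (if n = 0 then 1
     else - (\<Sum>k<n. of_nat (Suc n choose k) * bern k) / of_nat (Suc n))"

declare bern.simps [simp del]

lemma bern_0 [simp]: "bern 0 = 1"
  by (simp add: bern.simps)

lemma bern_1: "bern (Suc 0) = - 1 / 2"
  by (simp add: bern.simps [of "Suc 0"])

text \<open>For n >= 2 the terms with k < n cancel by the recurrence for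
  \<open>bern (n - 1)\<close>; for n = 1 the term B_0 = 1 survives.\<close>

lemma sum_binomial_bern:
  "(\<Sum>k\<le>n. of_nat (n choose k) * bern k) = bern n + (if n = 1 then 1 else 0)"
proof (cases "n < 2")
  case True
  then consider "n = 0" | "n = 1" by linarith
  then show ?thesis by cases auto
next
  case False
  then obtain m where n: "n = Suc m" "m > 0" by (cases n) auto
  have "(\<Sum>k<m. of_nat (Suc m choose k) * bern k) + of_nat (Suc m) * bern m = 0"
    using n by (subst (2) bern.simps) (simp del: of_nat_Suc)
  then have "(\<Sum>k<n. of_nat (n choose k) * bern k) = 0"
    unfolding n by (simp only: sum.lessThan_Suc binomial_Suc_n)
  then show ?thesis
    using False by (simp flip: lessThan_Suc_atMost)
qed

text \<open>Both sides count disjoint pairs of a k-subset and a j-subset, and vanish if k + j >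
  n.\<close>

lemma binomial_mult_swap:
  "(n choose k) * (n - k choose j) = (n choose j) * (n - j choose k)"
proof (cases "k + j \<le> n")
  case True
  then have "(n choose k) * (n - k choose j) = (n choose (k + j)) * ((k + j) choose k)"
    using choose_mult [of k "k + j" n] by simp
  also have "(k + j) choose k = (k + j) choose j"
    using binomial_symmetric [of k "k + j"] by simp
  also have "(n choose (k + j)) * ((k + j) choose j) = (n choose j) * (n - j choose k)"
    using choose_mult [of j "k + j" n] True by simp
  finally show ?thesis .
next
  case False
  then have "n < k \<or> n - k < j" "n < j \<or> n - j < k"
    by arith+
  then show ?thesis by (auto simp: binomial_eq_0)
qed

text \<open>This is B_n(x+1) - B_n(x) = n x^(n-1) for Bernoulli polynomials. After expanding and
  interchanging sums, the inner sum is \<open>sum_binomial_bern\<close> at n - j, whose extra 1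
  occurs only at j = n - 1.\<close>

lemma bernoulli_poly_shift:
  fixes x :: rat
  shows "(\<Sum>k\<le>n. of_nat (n choose k) * bern k * (x + 1) ^ (n - k)) =
         (\<Sum>k\<le>n. of_nat (n choose k) * bern k * x ^ (n - k)) + of_nat n * x ^ (n - 1)"
proof -
  have "(\<Sum>k\<le>n. of_nat (n choose k) * bern k * (x + 1) ^ (n - k)) =
        (\<Sum>k\<le>n. \<Sum>j\<le>n. of_nat ((n choose k) * (n - k choose j)) * bern k * x ^ j)"
  proof (rule sum.cong [OF refl])
    fix k
    have "(x + 1) ^ (n - k) = (\<Sum>j\<le>n - k. of_nat (n - k choose j) * x ^ j)"
      unfolding binomial_ring by simp
    \<comment> \<open>The added terms are zero, and the range no longer depends on k, so the sums
      can be interchanged.\<close>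
    also have "\<dots> = (\<Sum>j\<le>n. of_nat (n - k choose j) * x ^ j)"
      by (rule sum.mono_neutral_left) (auto simp: not_le binomial_eq_0)
    finally show "of_nat (n choose k) * bern k * (x + 1) ^ (n - k) =
        (\<Sum>j\<le>n. of_nat ((n choose k) * (n - k choose j)) * bern k * x ^ j)"
      by (simp add: sum_distrib_left mult_ac)
  qed
  also have "\<dots> = (\<Sum>j\<le>n. of_nat (n choose j) * x ^ j *
                       (\<Sum>k\<le>n. of_nat (n - j choose k) * bern k))"
    by (subst sum.swap) (simp add: binomial_mult_swap [of n] sum_distrib_left mult_ac)
  also have "\<dots> = (\<Sum>j\<le>n. of_nat (n choose j) * x ^ j *
                       (bern (n - j) + (if n - j = 1 then 1 else 0)))"
  proof (rule sum.cong [OF refl])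
    fix j
    have "(\<Sum>k\<le>n. of_nat (n - j choose k) * bern k) =
          (\<Sum>k\<le>n - j. of_nat (n - j choose k) * bern k)"
      by (rule sum.mono_neutral_right) (auto simp: not_le binomial_eq_0)
    then show "of_nat (n choose j) * x ^ j * (\<Sum>k\<le>n. of_nat (n - j choose k) * bern k) =
        of_nat (n choose j) * x ^ j * (bern (n - j) + (if n - j = 1 then 1 else 0))"
      by (simp only: sum_binomial_bern)
  qed
  also have "\<dots> = (\<Sum>j\<le>n. of_nat (n choose j) * x ^ j * bern (n - j)) +
      (\<Sum>j\<le>n. if n - j = 1 then of_nat (n choose j) * x ^ j else 0)"
    unfolding sum.distrib [symmetric] by (rule sum.cong) (auto simp: algebra_simps)
  also have "(\<Sum>j\<le>n. of_nat (n choose j) * x ^ j * bern (n - j)) =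
      (\<Sum>k\<le>n. of_nat (n choose k) * bern k * x ^ (n - k))"
    by (rule sum.reindex_bij_witness [of _ "\<lambda>k. n - k" "\<lambda>k. n - k"])
       (auto simp: binomial_symmetric [symmetric] mult_ac)
  also have "(\<Sum>j\<le>n. if n - j = 1 then of_nat (n choose j) * x ^ j else 0) =
      of_nat n * x ^ (n - 1)"
  proof (cases n)
    case (Suc m)
    have "(\<Sum>j\<le>n. if n - j = 1 then of_nat (n choose j) * x ^ j else 0) =
          (\<Sum>j\<in>{m}. of_nat (n choose j) * x ^ j)"
      using Suc by (intro sum.mono_neutral_cong_right) auto
    then show ?thesis using Suc by simp
  qed simp
  finally show ?thesis .
qed

text \<open>Telescopes \<open>bernoulli_poly_shift\<close> for \<open>Suc n\<close> at x = m; its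
  term k = n + 1 is constant in x and cancels.\<close>

lemma faulhaber:
  "(\<Sum>j<m. of_nat j ^ n) =
   (\<Sum>k\<le>n. of_nat (Suc n choose k) * bern k * of_nat m ^ (Suc n - k)) / (of_nat (Suc n) :: rat)"
  (is "_ = ?S m / _")
proof (induction m)
  case 0
  show ?case by (simp add: sum.neutral)
next
  case (Suc m)
  have "?S (Suc m) = ?S m + of_nat (Suc n) * of_nat m ^ n"
    using bernoulli_poly_shift [of "Suc n" "of_nat m"]
    by (simp add: add.commute [of 1] del: binomial_Suc_Suc)
  then show ?case
    by (simp add: Suc.IH add_divide_distrib del: of_nat_Suc binomial_Suc_Suc)
qed

section \<open>Coefficients of the power sum polynomial\<close>

definition faulhaber_poly :: "nat \<Rightarrow> rat poly" where
  "faulhaber_poly n =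
     (\<Sum>k\<le>n. monom (of_nat (Suc n choose k) * bern k / of_nat (Suc n)) (Suc n - k))"

lemma coeff_faulhaber_poly:
  "coeff (faulhaber_poly n) i =
     (if 0 < i \<and> i \<le> Suc n
      then of_nat (Suc n choose (Suc n - i)) * bern (Suc n - i) / of_nat (Suc n) else 0)"
proof -
  have "coeff (faulhaber_poly n) i =
    (\<Sum>k\<le>n. if Suc n - k = i
      then of_nat (Suc n choose k) * bern k / of_nat (Suc n) else 0)"
    by (simp add: faulhaber_poly_def coeff_sum coeff_monom del: binomial_Suc_Suc of_nat_Suc)
  also have "\<dots> = (\<Sum>k\<in>(if 0 < i \<and> i \<le> Suc n then {Suc n - i} else {}).
      of_nat (Suc n choose k) * bern k / of_nat (Suc n))"
    by (rule sum.mono_neutral_cong_right) (auto split: if_splits)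
  finally show ?thesis by simp
qed

lemma poly_faulhaber_poly:
  "poly (faulhaber_poly n) (of_nat m) = (\<Sum>j<m. of_nat j ^ n)"
  unfolding faulhaber
  by (simp add: faulhaber_poly_def poly_sum poly_monom sum_divide_distrib
      del: binomial_Suc_Suc of_nat_Suc)

text \<open>Faulhaber's formula sums over 0 <= j < x, so passing to 1 <= k <= x adds x^n and removes
  0^n, which is 1 when n = 0.\<close>

lemma power_sum_poly_eq:
  "power_sum_poly n = faulhaber_poly n + (monom 1 n - [:0 ^ n:])"
proof -
  let ?P = "faulhaber_poly n + (monom 1 n - [:0 ^ n:])"
  have "degree ?P = n + 1"
  proof (rule antisym)
    show "degree ?P \<le> n + 1"
      by (rule degree_le) (auto simp: coeff_faulhaber_poly coeff_pCons split: nat.split)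
    show "n + 1 \<le> degree ?P"
      by (rule le_degree) (simp add: coeff_faulhaber_poly del: of_nat_Suc)
  qed
  moreover have "poly ?P (of_nat x) = (\<Sum>k=1..x. of_nat k ^ n)" if "x > 0" for x :: nat
  proof -
    have "(\<Sum>j<x. of_nat j ^ n) + of_nat x ^ n = (\<Sum>j\<le>x. of_nat j ^ n :: rat)"
      by (simp flip: lessThan_Suc_atMost)
    also have "\<dots> = 0 ^ n + (\<Sum>k=1..x. of_nat k ^ n)"
      by (simp add: sum.atLeast_Suc_atMost flip: atLeast0AtMost)
    finally show ?thesis
      by (simp add: poly_faulhaber_poly poly_monom)
  qed
  ultimately have "is_power_sum_poly n ?P"
    by (simp add: is_power_sum_poly_def)
  then show ?thesis
    unfolding power_sum_poly_def using ex1_is_power_sum_poly by (rule the1_equality [rotated])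
qed

section \<open>Reduction to the quotient\<close>

text \<open>The correction x^n - 0^n has integer coefficients, so only the Faulhaber coefficients
  matter.\<close>

lemma integer_multiple_power_sum_poly_iff:
  "(\<forall>i. coeff (smult (of_nat d) (power_sum_poly n)) i \<in> \<int>) \<longleftrightarrow>
   (\<forall>k\<le>n. of_nat d * (of_nat (Suc n choose k) * bern k / of_nat (Suc n)) \<in> \<int>)"
proof -
  have *: "coeff (smult (of_nat d) (power_sum_poly n)) i \<in> \<int> \<longleftrightarrow>
      of_nat d * coeff (faulhaber_poly n) i \<in> \<int>" for i
  proof -
    have int: "of_nat d * coeff (monom 1 n - [:0 ^ n :: rat:]) i \<in> \<int>"
      by (auto simp: coeff_pCons split: nat.split)
    then show ?thesis
      using Ints_add [OF _ int] Ints_diff [OF _ int]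
      by (fastforce simp: power_sum_poly_eq distrib_left simp del: coeff_diff)
  qed
  show ?thesis
    unfolding * coeff_faulhaber_poly
  proof safe
    fix k
    assume "\<forall>i. of_nat d * (if 0 < i \<and> i \<le> Suc n
      then of_nat (Suc n choose (Suc n - i)) * bern (Suc n - i) / of_nat (Suc n) else 0) \<in> \<int>"
      and "k \<le> n"
    then show "of_nat d * (of_nat (Suc n choose k) * bern k / of_nat (Suc n)) \<in> \<int>"
      by (auto dest!: spec [of _ "Suc n - k"] simp del: of_nat_Suc binomial_Suc_Suc)
  qed (auto simp del: of_nat_Suc binomial_Suc_Suc)
qed

definition clears_bernoulli :: "nat \<Rightarrow> nat \<Rightarrow> bool" where
  "clears_bernoulli n q \<longleftrightarrow>
     q > 0 \<and> (\<forall>k\<le>n. of_nat q * (of_nat (Suc n choose k) * bern k) \<in> \<int>)"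

text \<open>The coefficient for k = 0 is 1/(n+1), which forces n + 1 to divide d; the common factor
  1/(n+1) then cancels.\<close>

lemma integer_multiple_iff_clears_bernoulli:
  "d > 0 \<and> (\<forall>i. coeff (smult (of_nat d) (power_sum_poly n)) i \<in> \<int>) \<longleftrightarrow>
   (\<exists>q. d = Suc n * q \<and> clears_bernoulli n q)" (is "?L \<longleftrightarrow> ?R")
proof
  assume L: ?L
  then have "of_nat d * (of_nat (Suc n choose 0) * bern 0 / of_nat (Suc n)) \<in> \<int>"
    unfolding integer_multiple_power_sum_poly_iff by blast
  then have "of_nat d / (of_nat (Suc n) :: rat) \<in> \<int>"
    by (simp only: binomial_n_0 bern_0 of_nat_1 mult_1_right times_divide_eq_right)
  then obtain z :: int where "of_nat d / (of_nat (Suc n) :: rat) = of_int z"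
    by (elim Ints_cases)
  then have "(of_int (int d) :: rat) = of_int (int (Suc n) * z)"
    by (simp add: field_simps del: of_nat_Suc)
  then have "int (Suc n) dvd int d"
    unfolding of_int_eq_iff by simp
  then obtain q where "d = Suc n * q"
    unfolding int_dvd_int_iff by blast
  then show ?R
    using L unfolding integer_multiple_power_sum_poly_iff clears_bernoulli_def
    by (auto simp del: of_nat_Suc binomial_Suc_Suc mult_Suc)
next
  assume ?R
  then show ?L
    unfolding integer_multiple_power_sum_poly_iff clears_bernoulli_def
    by (auto simp del: of_nat_Suc binomial_Suc_Suc mult_Suc)
qed

text \<open>Some admissible d exists, so the \<open>LEAST\<close> is attained and has the form
  \<open>Suc n * q\<close>; the division defining \<open>power_sum_quot\<close> is therefore
  exact.\<close>

lemma power_sum_denom_eq: "power_sum_denom n = (n + 1) * power_sum_quot n"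
  and clears_bernoulli_quot: "clears_bernoulli n (power_sum_quot n)"
proof -
  have "\<exists>d. d > 0 \<and> (\<forall>i. coeff (smult (of_nat d) (power_sum_poly n)) i \<in> \<int>)"
  proof -
    let ?c = "coeff (power_sum_poly n)"
    \<comment> \<open>The product of the denominators of all coefficients up to the degree n +
      1.\<close>
    define d where "d = (\<Prod>i\<le>n+1. nat (snd (quotient_of (?c i))))"
    have "d > 0"
      unfolding d_def by (intro prod_pos) (auto simp: quotient_of_denom_pos')
    moreover have "of_nat d * ?c i \<in> \<int>" for i
    proof (cases "i \<le> n + 1")
      case True
      then obtain e where e: "d = nat (snd (quotient_of (?c i))) * e"
        unfolding d_def by (metis dvd_prodI finite_atMost atMost_iff dvdE)
      obtain a b where ab: "quotient_of (?c i) = (a, b)"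
        by (cases "quotient_of (?c i)")
      then have "?c i = of_int a / of_int b" "b > 0"
        by (auto simp: quotient_of_div quotient_of_denom_pos)
      then have "of_nat d * ?c i = of_int (int e * a)"
        unfolding e ab by simp
      then show ?thesis by (metis Ints_of_int)
    next
      case False
      then have "?c i = 0"
        by (auto simp: power_sum_poly_eq coeff_faulhaber_poly coeff_pCons split: nat.split)
      then show ?thesis by simp
    qed
    ultimately show ?thesis by auto
  qed
  from LeastI_ex [OF this, folded power_sum_denom_def]
  obtain q where q: "power_sum_denom n = Suc n * q" "clears_bernoulli n q"
    unfolding integer_multiple_iff_clears_bernoulli by blast
  then have "power_sum_quot n = q"
    by (simp add: power_sum_quot_def del: mult_Suc)
  with q show "power_sum_denom n = (n + 1) * power_sum_quot n"
    and "clears_bernoulli n (power_sum_quot n)"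
    by simp_all
qed

lemma power_sum_quot_le:
  assumes "clears_bernoulli n q"
  shows "power_sum_quot n \<le> q"
proof -
  have "power_sum_denom n \<le> Suc n * q"
    unfolding power_sum_denom_def
    by (rule Least_le, unfold integer_multiple_iff_clears_bernoulli) (use assms in blast)
  then show ?thesis
    by (simp add: power_sum_denom_eq del: mult_Suc)
qed

section \<open>\<open>p\<close>-integrality of Bernoulli numbers\<close>

text \<open>For prime p this is membership in the localization of the integers at p; m may be any
  multiple of the reduced denominator that is prime to p.\<close>

definition p_integral :: "nat \<Rightarrow> rat \<Rightarrow> bool" where
  "p_integral p r \<longleftrightarrow> (\<exists>m. \<not> p dvd m \<and> of_nat m * r \<in> \<int>)"

lemma p_integral_Ints: "prime p \<Longrightarrow> r \<in> \<int> \<Longrightarrow> p_integral p r"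
  unfolding p_integral_def by (rule exI [of _ 1]) auto

lemma p_integral_add:
  assumes "prime p" "p_integral p r" "p_integral p s"
  shows "p_integral p (r + s)"
proof -
  obtain a b where "\<not> p dvd a" "of_nat a * r \<in> \<int>" "\<not> p dvd b" "of_nat b * s \<in> \<int>"
    using assms by (auto simp: p_integral_def)
  moreover have "of_nat (a * b) * (r + s) =
      of_nat b * (of_nat a * r) + of_nat a * (of_nat b * s)"
    by (simp add: algebra_simps)
  ultimately show ?thesis
    unfolding p_integral_def using \<open>prime p\<close>
    by (intro exI [of _ "a * b"]) (simp add: prime_dvd_mult_iff)
qed

lemma p_integral_mult:
  assumes "prime p" "p_integral p r" "p_integral p s"
  shows "p_integral p (r * s)"
proof -
  obtain a b where "\<not> p dvd a" "of_nat a * r \<in> \<int>" "\<not> p dvd b" "of_nat b * s \<in> \<int>"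
    using assms by (auto simp: p_integral_def)
  moreover have "of_nat (a * b) * (r * s) = (of_nat a * r) * (of_nat b * s)"
    by simp
  ultimately show ?thesis
    unfolding p_integral_def using \<open>prime p\<close>
    by (intro exI [of _ "a * b"]) (metis Ints_mult prime_dvd_mult_iff)
qed

lemma p_integral_diff:
  assumes "prime p" "p_integral p r" "p_integral p s"
  shows "p_integral p (r - s)"
  using p_integral_add [OF assms(1,2) p_integral_mult [OF assms(1) p_integral_Ints assms(3)],
      of "-1"] assms(1)
  by simp

lemma p_integral_sum:
  "prime p \<Longrightarrow> (\<And>i. i \<in> A \<Longrightarrow> p_integral p (f i)) \<Longrightarrow> p_integral p (sum f A)"
  by (induction A rule: infinite_finite_induct) (simp_all add: p_integral_Ints p_integral_add)

text \<open>If a clears r and is prime to p, a Bezout relation u p + v a = 1 writes m r as an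
  integer combination of p m r and a r.\<close>

lemma Ints_cancel_prime:
  assumes "prime p" "p_integral p r" "of_nat (p * m) * r \<in> \<int>"
  shows "of_nat m * r \<in> \<int>"
proof -
  obtain a where a: "\<not> p dvd a" "of_nat a * r \<in> \<int>"
    using assms by (auto simp: p_integral_def)
  then have "coprime (int p) (int a)"
    using assms(1) by (simp add: prime_imp_coprime)
  then obtain u v where uv: "u * int p + v * int a = 1"
    by (metis bezout_int coprime_imp_gcd_eq_1)
  have "of_nat m * r = of_int (u * int p + v * int a) * (of_nat m * r)"
    by (simp add: uv)
  also have "\<dots> = of_int u * (of_nat (p * m) * r) + of_int (v * int m) * (of_nat a * r)"
    by (simp add: algebra_simps)
  also have "\<dots> \<in> \<int>"
    using assms a by (intro Ints_add Ints_mult [OF Ints_of_int])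
  finally show ?thesis .
qed

text \<open>As p^e > m, the power of p in m is at most p^(e-1), so only the part of m prime to p
  stays in the denominator.\<close>

lemma p_integral_prime_power_div:
  assumes "prime p" "p ^ e > m" "m > 0"
  shows "p_integral p (of_nat p ^ (e - 1) / of_nat m)"
proof -
  define t where "t = multiplicity p m"
  have "p ^ t \<le> m"
    using assms(3) by (auto simp: t_def multiplicity_dvd dvd_imp_le)
  then have "p ^ t < p ^ e" using assms(2) by linarith
  then have "t < e"
    by (rule power_less_imp_less_exp [OF prime_gt_1_nat [OF assms(1)]])
  then have t: "t \<le> e - 1" by simp
  obtain u where u: "m = p ^ t * u" "\<not> p dvd u"
    using multiplicity_decompose' [of m p] assms unfolding t_def
    by (metis neq0_conv not_prime_unit)
  have "p ^ (e - 1) = p ^ (e - 1 - t) * p ^ t"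
    unfolding power_add [symmetric] using t by (simp only: le_add_diff_inverse2)
  then have "of_nat (p ^ (e - 1)) = (of_nat (p ^ (e - 1 - t)) * of_nat (p ^ t) :: rat)"
    by (simp only: of_nat_mult)
  moreover have "m \<noteq> 0" using assms(3) by simp
  ultimately have "of_nat u * (of_nat p ^ (e - 1) / of_nat m :: rat) = of_nat (p ^ (e - 1 - t))"
    unfolding u(1) by (simp add: field_simps)
  then show ?thesis
    unfolding p_integral_def using u(2) by (metis Ints_of_nat)
qed

section \<open>Faulhaber's formula at a prime\<close>

text \<open>\<open>faulhaber\<close> at m = p with the term i = k isolated. Absorption turns
  C(k+1,i)/(k+1) into C(k,i)/(k-i+1), so that each summand contains p B_i as a factor, ready for
  induction.\<close>

lemma bern_recurrence:
  assumes "p > 0"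
  shows "of_nat p * bern k =
    (\<Sum>j<p. of_nat j ^ k) -
    (\<Sum>i<k. of_nat (k choose i) * (of_nat p * bern i) *
      (of_nat p ^ (k - i) / of_nat (Suc (k - i))))"
proof -
  have *: "of_nat (Suc k choose i) / (of_nat (Suc k) :: rat) =
      of_nat (k choose i) / of_nat (Suc (k - i))" if "i \<le> k" for i
  proof -
    have "(Suc k - i) * (Suc k choose i) = Suc k * (k choose i)"
      using binomial_absorb_comp [of "Suc k" i] by simp
    then have "of_nat (Suc (k - i)) * of_nat (Suc k choose i) =
        (of_nat (Suc k) * of_nat (k choose i) :: rat)"
      using that by (simp only: of_nat_mult [symmetric] Suc_diff_le)
    then show ?thesis by (simp add: field_simps del: of_nat_Suc)
  qed
  have "(\<Sum>j<p. of_nat j ^ k) =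
      (\<Sum>i\<le>k. of_nat (Suc k choose i) / of_nat (Suc k) * bern i * of_nat p ^ (Suc k - i))"
    unfolding faulhaber by (simp add: sum_divide_distrib del: of_nat_Suc binomial_Suc_Suc)
  also have "\<dots> = (\<Sum>i\<le>k. of_nat (k choose i) * (of_nat p * bern i) *
      (of_nat p ^ (k - i) / of_nat (Suc (k - i))))"
    by (rule sum.cong [OF refl]) (simp add: * Suc_diff_le del: of_nat_Suc binomial_Suc_Suc)
  also have "\<dots> = (\<Sum>i<k. of_nat (k choose i) * (of_nat p * bern i) *
      (of_nat p ^ (k - i) / of_nat (Suc (k - i)))) + of_nat p * bern k"
    by (simp flip: lessThan_Suc_atMost)
  finally show ?thesis by simp
qed

text \<open>Strong induction along \<open>bern_recurrence\<close>: the power factors are p-integral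
  because k-i+1 < 2^(k-i+1) <= p^(k-i+1).\<close>

lemma p_integral_mult_bern:
  assumes "prime p"
  shows "p_integral p (of_nat p * bern k)"
proof (induction k rule: less_induct)
  case (less k)
  have "p > 0" using assms by (simp add: prime_gt_0_nat)
  have pow: "p_integral p (of_nat p ^ (k - i) / of_nat (Suc (k - i)))" for i
  proof -
    have "Suc (k - i) < 2 ^ Suc (k - i)" by (rule less_exp)
    also have "\<dots> \<le> p ^ Suc (k - i)"
      using assms by (intro power_mono) (auto simp: prime_ge_2_nat)
    finally show ?thesis
      using p_integral_prime_power_div [OF assms, of "Suc (k - i)" "Suc (k - i)"] by simp
  qed
  then show ?case
    unfolding bern_recurrence [OF \<open>p > 0\<close>, of k]
    by (intro p_integral_diff p_integral_sum assms
          p_integral_mult [OF assms p_integral_mult [OF assms _ less] pow])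
       (simp_all add: p_integral_Ints assms)
qed

text \<open>The division by p is charged to the power p^(k-i), whose exponent is positive for i < k;
  the factors p B_i stay intact.\<close>

lemma bern_recurrence_div:
  assumes "p > 0"
  shows "bern k = (\<Sum>j<p. of_nat j ^ k) / of_nat p -
    (\<Sum>i<k. of_nat (k choose i) * (of_nat p * bern i) *
      (of_nat p ^ (k - i - 1) / of_nat (Suc (k - i))))"
proof -
  have "bern k = of_nat p * bern k / of_nat p"
    using assms by simp
  also have "\<dots> = (\<Sum>j<p. of_nat j ^ k) / of_nat p -
    (\<Sum>i<k. of_nat (k choose i) * (of_nat p * bern i) *
      (of_nat p ^ (k - i) / of_nat (Suc (k - i)))) / of_nat p"
    by (subst bern_recurrence [OF assms]) (simp only: diff_divide_distrib)
  also have "(\<Sum>i<k. of_nat (k choose i) * (of_nat p * bern i) *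
      (of_nat p ^ (k - i) / of_nat (Suc (k - i)))) / of_nat p =
    (\<Sum>i<k. of_nat (k choose i) * (of_nat p * bern i) *
      (of_nat p ^ (k - i - 1) / of_nat (Suc (k - i))))"
    unfolding sum_divide_distrib
  proof (rule sum.cong [OF refl])
    fix i assume "i \<in> {..<k}"
    then obtain d where d: "k - i = Suc d"
      by (metis lessThan_iff less_imp_Suc_add add_Suc_right add_diff_cancel_left')
    show "of_nat (k choose i) * (of_nat p * bern i) *
        (of_nat p ^ (k - i) / of_nat (Suc (k - i))) / of_nat p =
      of_nat (k choose i) * (of_nat p * bern i) *
        (of_nat p ^ (k - i - 1) / of_nat (Suc (k - i)))"
      unfolding d using assms by (simp del: of_nat_Suc)
  qed
  finally show ?thesis .
qed

text \<open>Here m + 1 < p^m. The excluded case p = 2, m = 1 is a true exception: the quotient is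
  then 1/2.\<close>

lemma p_integral_prime_power_div':
  assumes "prime p" "m > 0" "p \<noteq> 2 \<or> m \<noteq> 1"
  shows "p_integral p (of_nat p ^ (m - 1) / of_nat (Suc m))"
proof (rule p_integral_prime_power_div)
  show "Suc m < p ^ m"
  proof (cases "p = 2")
    case True
    have "Suc (Suc (Suc j)) < 2 ^ Suc (Suc j)" for j :: nat
      by (induction j) auto
    then show ?thesis
      using True assms(2,3) by (metis One_nat_def gr0_implies_Suc neq0_conv)
  next
    case False
    then have "3 \<le> p" using prime_ge_2_nat [OF assms(1)] by simp
    have "Suc (Suc j) < 3 ^ Suc j" for j :: nat
      by (induction j) auto
    then have "Suc m < 3 ^ m"
      using assms(2) by (metis gr0_implies_Suc)
    also have "\<dots> \<le> p ^ m"
      using \<open>3 \<le> p\<close> by (simp add: power_mono)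
    finally show ?thesis .
  qed
qed (use assms in auto)

section \<open>Integrality as in the von Staudt-Clausen theorem\<close>

text \<open>Multiplication by a primitive root g permutes the residues, so the sum S satisfies S =
  g^k S modulo p, while g^k is not 1 because g has order p - 1.\<close>

lemma prime_dvd_sum_powers:
  assumes "prime p" "\<not> (p - 1) dvd k"
  shows "p dvd (\<Sum>j<p. j ^ k)"
proof -
  have "p > 1" using assms(1) by (rule prime_gt_1_nat)
  obtain g where "residue_primroot p g"
    using prime_primitive_root_exists [OF \<open>p > 1\<close> assms(1)] by blast
  then have cop: "coprime g p" and ord: "ord p g = p - 1"
    using assms(1) by (auto simp: residue_primroot_def totient_prime coprime_commute)
  have "inj_on (\<lambda>j. g * j mod p) {..<p}"
  proof (rule inj_onI)
    fix x y assume "x \<in> {..<p}" "y \<in> {..<p}" "g * x mod p = g * y mod p"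
    then show "x = y"
      using cong_mult_lcancel_nat [OF cop, of x y] by (simp add: cong_def)
  qed
  moreover have "(\<lambda>j. g * j mod p) ` {..<p} \<subseteq> {..<p}"
    using \<open>p > 1\<close> by auto
  ultimately have "bij_betw (\<lambda>j. g * j mod p) {..<p} {..<p}"
    using endo_inj_surj [of "{..<p}"] by (simp add: bij_betw_def)
  then have "(\<Sum>j<p. j ^ k) = (\<Sum>j<p. (g * j mod p) ^ k)"
    by (rule sum.reindex_bij_betw [symmetric])
  also have "[\<dots> = (\<Sum>j<p. (g * j) ^ k)] (mod p)"
    by (intro cong_sum cong_pow) (simp add: cong_def)
  also have "(\<Sum>j<p. (g * j) ^ k) = g ^ k * (\<Sum>j<p. j ^ k)"
    by (simp add: power_mult_distrib sum_distrib_left)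
  finally have "[int (\<Sum>j<p. j ^ k) = int (g ^ k * (\<Sum>j<p. j ^ k))] (mod int p)"
    by (simp only: cong_int_iff)
  then have "int p dvd (1 - int (g ^ k)) * int (\<Sum>j<p. j ^ k)"
    by (simp add: cong_iff_dvd_diff algebra_simps)
  moreover have "\<not> int p dvd 1 - int (g ^ k)"
  proof
    assume "int p dvd 1 - int (g ^ k)"
    then have "[int 1 = int (g ^ k)] (mod int p)"
      by (simp add: cong_iff_dvd_diff)
    then have "[g ^ k = 1] (mod p)"
      using cong_int_iff cong_sym by blast
    then show False
      using assms(2) ord ord_divides [of g k p] by simp
  qed
  ultimately show ?thesis
    using assms(1) by (simp add: prime_dvd_mult_iff del: of_nat_sum)
qed

text \<open>In \<open>bern_recurrence_div\<close> the power sum is now divisible by p. The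
  hypothesis excludes p = 2, hence also the exception in
  \<open>p_integral_prime_power_div'\<close>.\<close>

lemma p_integral_bern:
  assumes "prime p" "\<not> (p - 1) dvd k"
  shows "p_integral p (bern k)"
proof -
  have "p > 0" using assms(1) by (simp add: prime_gt_0_nat)
  have "p \<noteq> 2" using assms(2) by auto
  obtain s where s: "(\<Sum>j<p. j ^ k) = p * s"
    using prime_dvd_sum_powers [OF assms] by blast
  have "(\<Sum>j<p. of_nat j ^ k) / of_nat p = (of_nat s :: rat)"
    using s \<open>p > 0\<close> by (simp flip: of_nat_power of_nat_sum)
  then show ?thesis
    unfolding bern_recurrence_div [OF \<open>p > 0\<close>, of k] using assms \<open>p \<noteq> 2\<close>
    by (intro p_integral_diff p_integral_sum p_integral_mult p_integral_mult_bern
          p_integral_prime_power_div') (auto intro!: p_integral_Ints)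
qed

text \<open>For p = 2 and k > 0 the sum of j^k over j < 2 is 1, which contributes the 1/2 in
  \<open>bern_recurrence_div\<close>; for k = 1 the difference is -1.\<close>

lemma two_integral_bern_minus_half:
  assumes "even k \<and> k > 0 \<or> k = 1"
  shows "p_integral 2 (bern k - 1 / 2)"
proof (cases "k = 1")
  case True
  then show ?thesis by (simp add: bern_1 p_integral_Ints)
next
  case False
  let ?t = "\<lambda>i. of_nat (k choose i) * (of_nat 2 * bern i) *
      (of_nat 2 ^ (k - i - 1) / of_nat (Suc (k - i)))"
  obtain m where k: "k = 2 * Suc m"
    using False assms by (metis dvdE gr0_implies_Suc mult_0_right neq0_conv)
  have "p_integral 2 (?t i)" if "i < k" for i
  proof (cases "Suc i = k")
    \<comment> \<open>This is the exceptional term with power factor 1/2; its denominator cancels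
      because C(k,k-1) = k is even.\<close>
    case True
    then have "?t i = of_nat (Suc m) * (of_nat 2 * bern i)"
      using k by (auto simp: binomial_Suc_n field_simps)
    then show ?thesis
      by (metis p_integral_mult p_integral_Ints p_integral_mult_bern two_is_prime_nat Ints_of_nat)
  next
    case False
    then show ?thesis using that
      by (intro p_integral_mult p_integral_mult_bern p_integral_prime_power_div')
         (auto intro!: p_integral_Ints)
  qed
  then have "p_integral 2 (0 - (\<Sum>i<k. ?t i))"
    by (intro p_integral_diff p_integral_sum) (auto intro!: p_integral_Ints)
  moreover have "bern k - 1 / 2 = 0 - (\<Sum>i<k. ?t i)"
    by (subst bern_recurrence_div [of 2 k]) (use k in \<open>simp_all add: numeral_2_eq_2\<close>)
  ultimately show ?thesis by simp
qed

section \<open>Primes dividing the quotient\<close>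

text \<open>If p divides q_n and all the products are p-integral, then q_n / p also clears them,
  against minimality. Conversely, a q_n prime to p would itself witness p-integrality.\<close>

lemma prime_dvd_quot_iff:
  assumes "prime p"
  shows "p dvd power_sum_quot n \<longleftrightarrow>
    (\<exists>k\<le>n. \<not> p_integral p (of_nat (Suc n choose k) * bern k))"
proof
  assume "p dvd power_sum_quot n"
  then obtain m where m: "power_sum_quot n = p * m" by blast
  show "\<exists>k\<le>n. \<not> p_integral p (of_nat (Suc n choose k) * bern k)"
  proof (rule ccontr)
    assume "\<not> ?thesis"
    then have "clears_bernoulli n m"
      using clears_bernoulli_quot [of n] Ints_cancel_prime [OF assms]
      unfolding clears_bernoulli_def m by auto
    then have "p * m \<le> m" "m > 0"
      using power_sum_quot_le [of n m] by (auto simp: m clears_bernoulli_def)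
    then show False
      using prime_gt_1_nat [OF assms] by simp
  qed
next
  assume "\<exists>k\<le>n. \<not> p_integral p (of_nat (Suc n choose k) * bern k)"
  then show "p dvd power_sum_quot n"
    using clears_bernoulli_quot [of n] by (auto simp: clears_bernoulli_def p_integral_def)
qed

text \<open>If q_n = p p m, attach one p to B_k; since p B_k is p-integral, the other p can be
  cancelled, so the smaller number p m already clears all denominators.\<close>

lemma squarefree_power_sum_quot: "squarefree (power_sum_quot n)"
proof -
  have "power_sum_quot n > 0"
    using clears_bernoulli_quot [of n] by (simp add: clears_bernoulli_def)
  moreover have "\<not> p ^ 2 dvd power_sum_quot n" if p: "prime p" for p
  proof
    assume "p ^ 2 dvd power_sum_quot n"
    then obtain m where m: "power_sum_quot n = p * (p * m)"
      by (metis dvdE mult.assoc power2_eq_square)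
    have "of_nat (p * m) * (of_nat (Suc n choose k) * bern k) \<in> \<int>" if "k \<le> n" for k
    proof -
      have "of_nat (p * (p * m)) * (of_nat (Suc n choose k) * bern k) \<in> \<int>"
        using clears_bernoulli_quot [of n] that unfolding clears_bernoulli_def m by blast
      then have *: "of_nat (p * m) * (of_nat (Suc n choose k) * (of_nat p * bern k)) \<in> \<int>"
        by (simp only: of_nat_mult mult_ac)
      have "of_nat m * (of_nat (Suc n choose k) * (of_nat p * bern k)) \<in> \<int>"
        by (rule Ints_cancel_prime [OF p _ *])
          (intro p_integral_mult p_integral_mult_bern p_integral_Ints p Ints_of_nat)
      then show ?thesis
        by (simp only: of_nat_mult mult_ac)
    qed
    then have "clears_bernoulli n (p * m)"
      using \<open>power_sum_quot n > 0\<close> by (auto simp: clears_bernoulli_def m)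
    from power_sum_quot_le [OF this] show False
      using \<open>power_sum_quot n > 0\<close> prime_gt_1_nat [OF p] by (simp add: m)
  qed
  ultimately show ?thesis
    by (auto simp: squarefree_factorial_semiring)
qed

text \<open>For every other k the product is p-integral: it is 1 at k = 0, B_k is p-integral if p -
  1 does not divide k, and a factor p of the binomial coefficient is absorbed into p B_k.\<close>

lemma prime_dvd_quotE:
  assumes "prime p" "p dvd power_sum_quot n"
  obtains k where "0 < k" "k \<le> n" "(p - 1) dvd k" "\<not> p dvd (Suc n choose k)"
proof -
  obtain k where k: "k \<le> n" and np: "\<not> p_integral p (of_nat (Suc n choose k) * bern k)"
    using assms prime_dvd_quot_iff by blast
  have "k > 0"
    using np p_integral_Ints [OF assms(1)] by (cases "k = 0") auto
  moreover have "(p - 1) dvd k"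
  proof (rule ccontr)
    assume "\<not> (p - 1) dvd k"
    then have "p_integral p (of_nat (Suc n choose k) * bern k)"
      by (intro p_integral_mult p_integral_Ints p_integral_bern assms(1) Ints_of_nat)
    then show False using np by contradiction
  qed
  moreover have "\<not> p dvd (Suc n choose k)"
  proof
    assume "p dvd (Suc n choose k)"
    then obtain c where "Suc n choose k = p * c" by blast
    then have eq: "of_nat (Suc n choose k) * bern k = of_nat c * (of_nat p * bern k)"
      by (simp only: of_nat_mult mult_ac)
    have "p_integral p (of_nat (Suc n choose k) * bern k)"
      unfolding eq by (intro p_integral_mult p_integral_mult_bern p_integral_Ints assms(1) Ints_of_nat)
    then show False using np by contradiction
  qed
  ultimately show ?thesis using that k by blast
qed

text \<open>With C the binomial coefficient, 2-integrality of C B_k and of C (B_k - 1/2) would make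
  C/2 2-integral, impossible for odd C.\<close>

lemma two_dvd_quotI:
  assumes "even k \<and> k > 0 \<or> k = 1" "k \<le> n" "odd (Suc n choose k)"
  shows "even (power_sum_quot n)"
proof -
  let ?c = "of_nat (Suc n choose k) :: rat"
  have "\<not> p_integral 2 (?c * bern k)"
  proof
    assume "p_integral 2 (?c * bern k)"
    moreover have "p_integral 2 (?c * (bern k - 1 / 2))"
      using assms(1) by (intro p_integral_mult two_integral_bern_minus_half) (auto intro: p_integral_Ints)
    ultimately have "p_integral 2 (?c * bern k - ?c * (bern k - 1 / 2))"
      by (intro p_integral_diff) auto
    then have "p_integral 2 (?c / 2)"
      by (simp add: algebra_simps del: binomial_Suc_Suc)
    then obtain m where m: "odd m" "of_nat m * (?c / 2) \<in> \<int>"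
      unfolding p_integral_def by blast
    then obtain z where "of_nat m * (?c / 2) = of_int z"
      by (elim Ints_cases)
    then have "(of_int (int (m * (Suc n choose k))) :: rat) = of_int (2 * z)"
      by (simp add: field_simps del: binomial_Suc_Suc)
    then have "int (m * (Suc n choose k)) = 2 * z"
      unfolding of_int_eq_iff .
    then have "even (m * (Suc n choose k))"
      by presburger
    then show False using m(1) assms(3) by simp
  qed
  then show ?thesis
    using prime_dvd_quot_iff [OF two_is_prime_nat] assms(2) by blast
qed

section \<open>Binomial coefficients modulo primes\<close>

text \<open>From k C(2^r,k) = 2^r C(2^r-1,k-1), an odd binomial coefficient would force 2^r to
  divide k.\<close>

lemma even_binomial_two_power:
  assumes "0 < k" "k < 2 ^ r"
  shows "even ((2 :: nat) ^ r choose k)"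
proof (rule ccontr)
  assume "odd ((2 :: nat) ^ r choose k)"
  then have "coprime (2 ^ r) ((2 :: nat) ^ r choose k)"
    by (intro coprime_power_left_iff [THEN iffD2]) simp
  moreover have "2 ^ r dvd k * ((2 :: nat) ^ r choose k)"
    unfolding times_binomial_minus1_eq [OF assms(1)] by (rule dvd_triv_left)
  ultimately have "2 ^ r dvd k"
    using coprime_dvd_mult_left_iff by blast
  then have "2 ^ r \<le> k" using assms(1) by (rule dvd_imp_le)
  then show False using assms(2) by simp
qed

lemma even_quot_iff: "even (power_sum_quot n) \<longleftrightarrow> (\<nexists>r. Suc n = 2 ^ r)"
proof
  assume "even (power_sum_quot n)"
  then obtain k where "0 < k" "k \<le> n" "odd (Suc n choose k)"
    using prime_dvd_quotE [OF two_is_prime_nat] by blast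
  moreover have "k < Suc n" using \<open>k \<le> n\<close> by simp
  ultimately show "\<nexists>r. Suc n = 2 ^ r"
    using even_binomial_two_power [of k] by metis
next
  assume neq: "\<nexists>r. Suc n = 2 ^ r"
  define a where "a = multiplicity 2 (Suc n)"
  obtain m where m: "Suc n = 2 ^ a * m" "odd m"
    using multiplicity_decompose' [of "Suc n" 2] unfolding a_def by auto
  have "m \<noteq> 0" using m(2) by (intro notI) simp
  moreover have "m \<noteq> 1"
  proof
    assume "m = 1"
    then have "Suc n = 2 ^ a" by (simp only: m(1) mult_1_right)
    then show False using neq by blast
  qed
  ultimately have "m > 1" by simp
  \<comment> \<open>With k = 2^a the binomial coefficient has the same power of 2 as the odd number
    m, so it is odd.\<close>
  have "multiplicity 2 (2 ^ a * m choose 2 ^ a) = multiplicity 2 m"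
    using \<open>m > 1\<close> by (intro const_p_fac) auto
  also have "\<dots> = 0" using m(2) by (simp add: not_dvd_imp_multiplicity_0)
  finally have "odd (Suc n choose 2 ^ a)"
    unfolding m(1) using \<open>m > 1\<close> by (auto simp: multiplicity_eq_zero_iff)
  moreover have "2 ^ a < Suc n" unfolding m(1) using \<open>m > 1\<close> by simp
  then have "2 ^ a \<le> n" by simp
  moreover have "even ((2 :: nat) ^ a) \<and> (2 :: nat) ^ a > 0 \<or> (2 :: nat) ^ a = 1"
    by (cases a) auto
  ultimately show "even (power_sum_quot n)"
    using two_dvd_quotI by blast
qed

text \<open>The case of Lucas's theorem with a one-digit lower index. In Vandermonde's identity p
  divides C(p,i) for 0 < i <= k < p, so removing p from the top changes nothing modulo p.\<close>

lemma binomial_cong_mod_prime: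
  assumes "prime p" "k < p"
  shows "[n choose k = n mod p choose k] (mod p)"
proof -
  have step: "[p + a choose k = a choose k] (mod p)" for a
  proof -
    have "p + a choose k = (\<Sum>i\<le>k. (p choose i) * (a choose (k - i)))"
      by (rule vandermonde [symmetric])
    also have "\<dots> = (a choose k) + (\<Sum>i\<in>{..k}-{0}. (p choose i) * (a choose (k - i)))"
      by (subst sum.remove [of _ 0]) auto
    also have "[\<dots> = (a choose k) + 0] (mod p)"
    proof (intro cong_add cong_refl)
      have "p dvd (\<Sum>i\<in>{..k}-{0}. (p choose i) * (a choose (k - i)))"
        using assms by (intro dvd_sum dvd_mult2 dvd_choose_prime) auto
      then show "[(\<Sum>i\<in>{..k}-{0}. (p choose i) * (a choose (k - i))) = 0] (mod p)"
        by (simp add: cong_0_iff)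
    qed
    finally show ?thesis by simp
  qed
  have "[t * p + a choose k = a choose k] (mod p)" for t a
  proof (induction t)
    case (Suc t)
    have "[p + (t * p + a) choose k = t * p + a choose k] (mod p)" by (rule step)
    then show ?case using Suc by (auto simp: add.assoc intro: cong_trans)
  qed simp
  from this [of "n div p" "n mod p"] show ?thesis by simp
qed

lemma le_mod_if_not_dvd_binomial:
  assumes "prime p" "k < p" "\<not> p dvd (n choose k)"
  shows "k \<le> n mod p"
proof (rule ccontr)
  assume "\<not> k \<le> n mod p"
  then have "n mod p choose k = 0" by simp
  then have "[n choose k = 0] (mod p)"
    using binomial_cong_mod_prime [OF assms(1,2), of n] by metis
  then show False using assms(3) by (simp add: cong_0_iff)
qed

section \<open>Size of the primes dividing the quotient\<close>

text \<open>Write p = q + 1 and k = q j. Large j makes n large directly since k <= n; for small j, p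
  not dividing C(n+1,k) restricts n + 1 modulo p. For odd n, parity supplies the last unit
  needed.\<close>

lemma prime_dvd_quot_bounds:
  assumes p: "prime p" "p dvd power_sum_quot n"
  shows "2 * p \<le> n + 2" and "odd n \<Longrightarrow> 3 * p \<le> n + 2"
proof -
  obtain k where k: "0 < k" "k \<le> n" "(p - 1) dvd k" "\<not> p dvd (Suc n choose k)"
    using prime_dvd_quotE [OF p] .
  obtain j where j: "k = (p - 1) * j" using k(3) by blast
  obtain q where q: "p = Suc q" "q > 0"
    using prime_gt_1_nat [OF p(1)] by (cases p) auto
  have kq: "k = q * j" using j q by simp
  have "j \<noteq> 0" using k(1) j by auto
  have mod_top: "Suc n mod p = q" if "j = 1"
  proof (rule antisym)
    show "Suc n mod p \<le> q"
      using mod_less_divisor [of p "Suc n"] q by simp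
    show "q \<le> Suc n mod p"
      by (rule le_mod_if_not_dvd_binomial) (use p(1) k(4) that j q in auto)
  qed
  \<comment> \<open>Here k = q <= n gives n + 1 >= p, so the quotient t is positive.\<close>
  have one: "\<exists>t. t > 0 \<and> Suc n = p * t + q" if "j = 1"
  proof (intro exI conjI)
    show "Suc n = p * (Suc n div p) + q"
      using mod_top [OF that] mult_div_mod_eq [of p "Suc n"] by simp
    show "Suc n div p > 0"
      using k(2) that j q by (simp add: div_greater_zero_iff)
  qed
  show "2 * p \<le> n + 2"
  proof (cases "j = 1")
    case True
    then obtain t where "t > 0" "Suc n = p * t + q" using one by blast
    moreover from \<open>t > 0\<close> have "p * 1 \<le> p * t" by (intro mult_le_mono) auto
    ultimately show ?thesis using q by simp
  next
    case False
    then have "q * 2 \<le> q * j" using \<open>j \<noteq> 0\<close> by (intro mult_le_mono) auto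
    then have "2 * q \<le> n" using k(2) kq by linarith
    then show ?thesis using q by simp
  qed
  then have lower: "2 * q \<le> n" using q by simp
  assume "odd n"
  show "3 * p \<le> n + 2"
  proof (cases "p = 2")
    \<comment> \<open>For p = 2 the only odd n below the bound are 1 and 3; there n + 1 is a power
      of 2, so q_n is odd.\<close>
    case True
    then have "even (power_sum_quot n)" using p(2) by simp
    then have "Suc n \<noteq> 2 ^ 1" "Suc n \<noteq> 2 ^ 2"
      unfolding even_quot_iff by blast+
    then have "n \<noteq> 1" "n \<noteq> 3" by auto
    with \<open>odd n\<close> have "n \<ge> 4" by presburger
    then show ?thesis using True by simp
  next
    case False
    then have "odd p" using p(1) primes_dvd_imp_eq two_is_prime_nat by blast
    then have "even q" using q by simp
    consider "j = 1" | "j = 2" | "j \<ge> 3" using \<open>j \<noteq> 0\<close> by linarith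
    then show ?thesis
    proof cases
      case 1
      then obtain t where t: "t > 0" "Suc n = p * t + q" using one by blast
      \<comment> \<open>As p is odd, t is even, hence t >= 2 and n + 1 >= 2 p + q = 3 p - 1.\<close>
      then have "even (p * t)" using \<open>odd n\<close> \<open>even q\<close> by presburger
      then have "t \<noteq> 1" using \<open>odd p\<close> by auto
      then have "p * 2 \<le> p * t" using t(1) by (intro mult_le_mono) auto
      then show ?thesis using t q by simp
    next
      case 2
      show ?thesis
      proof (rule ccontr)
        assume "\<not> 3 * p \<le> n + 2"
        then have upper: "n < 3 * q + 1" using q by simp
        \<comment> \<open>Parity sharpens the range to 2 q < n < 3 q, so b is the residue of n + 1
          modulo p and b + 2 < p.\<close>
        define b where "b = Suc n - 2 * p"
        have "n \<noteq> 2 * q" "n \<noteq> 3 * q" using \<open>odd n\<close> \<open>even q\<close> by auto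
        then have b: "Suc n = 2 * p + b" "b + 2 < p"
          using lower upper q by (auto simp: b_def)
        \<comment> \<open>Symmetry replaces k = 2 q by n + 1 - 2 q = b + 2, a lower index below p,
          and \<open>le_mod_if_not_dvd_binomial\<close> yields the absurd b + 2 <= b.\<close>
        have "Suc n choose k = Suc n choose (b + 2)"
          using binomial_symmetric [of k "Suc n"] b 2 j q by simp
        then have "b + 2 \<le> Suc n mod p"
          using le_mod_if_not_dvd_binomial [OF p(1) b(2), of "Suc n"] k(4) by simp
        moreover have "Suc n mod p = b" using b by simp
        ultimately show False by simp
      qed
    next
      case 3
      then have "q * 3 \<le> q * j" by (intro mult_le_mono) auto
      then have "3 * q \<le> n" using k(2) kq by linarith
      moreover have "n \<noteq> 3 * q" using \<open>odd n\<close> \<open>even q\<close> by auto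
      ultimately show ?thesis using q by simp
    qed
  qed
qed

section \<open>Power-sum denominators\<close>

theorem theorem1:
  fixes n :: nat
  shows "(\<forall>p::nat. prime p \<and> p dvd power_sum_denom n \<longrightarrow> p \<le> n + 1) \<and>
         ((n + 1) dvd power_sum_denom n \<and> squarefree (power_sum_quot n)) \<and>
         ((n \<ge> 1 \<longrightarrow> even (power_sum_denom n)) \<and>
          (odd (power_sum_quot n) \<longleftrightarrow> (\<exists>r::nat. n = 2 ^ r - 1))) \<and>
         (\<forall>p::nat. prime p \<and> p dvd power_sum_quot n \<longrightarrow> of_nat p \<le> power_sum_bound n)"
proof (intro conjI allI impI)
  fix p :: nat
  assume p: "prime p \<and> p dvd power_sum_denom n"
  then consider "p dvd n + 1" | "p dvd power_sum_quot n"
    unfolding power_sum_denom_eq using prime_dvd_mult_iff by blast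
  then show "p \<le> n + 1"
  proof cases
    case 1
    then show ?thesis by (simp add: dvd_imp_le)
  next
    case 2
    then show ?thesis
      \<comment> \<open>From 2 p <= n + 2 and p >= 2 even p <= n follows.\<close>
      using prime_dvd_quot_bounds(1) [of p n] p prime_ge_2_nat [of p] by simp
  qed
next
  show "(n + 1) dvd power_sum_denom n"
    unfolding power_sum_denom_eq by (rule dvd_triv_left)
  show "squarefree (power_sum_quot n)"
    by (rule squarefree_power_sum_quot)
next
  assume "n \<ge> 1"
  show "even (power_sum_denom n)"
  \<comment> \<open>One of the factors n + 1 and q_n is even: an odd n + 1 > 1 is not a power of
    2.\<close>
  proof (cases "even (n + 1)")
    case False
    have "even (power_sum_quot n)"
      unfolding even_quot_iff
    proof
      assume "\<exists>r. Suc n = 2 ^ r"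
      then obtain r where "Suc n = 2 ^ r" ..
      then show False using False \<open>n \<ge> 1\<close> by (cases r) auto
    qed
    then show ?thesis by (simp add: power_sum_denom_eq)
  qed (simp add: power_sum_denom_eq)
next
  \<comment> \<open>The subtraction on \<open>nat\<close> is exact because 2^r >= 1.\<close>
  have "Suc n = 2 ^ r \<longleftrightarrow> n = 2 ^ r - 1" for r
    using one_le_power [of "2 :: nat" r] by linarith
  then show "odd (power_sum_quot n) \<longleftrightarrow> (\<exists>r::nat. n = 2 ^ r - 1)"
    by (simp add: even_quot_iff)
next
  fix p :: nat
  assume "prime p \<and> p dvd power_sum_quot n"
  then have "2 * p \<le> n + 2" "odd n \<Longrightarrow> 3 * p \<le> n + 2"
    using prime_dvd_quot_bounds by blast+
  then have "of_nat (2 * p) \<le> (of_nat (n + 2) :: rat)"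
    "odd n \<Longrightarrow> of_nat (3 * p) \<le> (of_nat (n + 2) :: rat)"
    unfolding of_nat_le_iff by blast+
  then show "of_nat p \<le> power_sum_bound n"
    by (auto simp: power_sum_bound_def field_simps)
qed

end
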